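(* Let $\{\xi_j\}_{j=1}^M\subset\mathbb{R}^d$ be the nodes of an $M$-point quadrature rule with positive weights $\tau_j>0$ that is exact on $P_\Lambda^3$, i.e. $\int_{\mathbb{R}^d}p\,\rho\,d\xi=\sum_{j=1}^M p(\xi_j)\tau_j$ for all $p\in P_\Lambda^3$. Consider one Forward Euler step, from time $t^n$ to $t^{n+1}=t^n+\Delta t^n$ with $\Delta t^n>0$, of the central-upwind scheme for the stochastic Galerkin shallow water system, as described in the context, so that in particular $$\overline{\mathbf h}_i^{n+1}=\overline{\mathbf h}_i^n-\frac{\Delta t^n}{\Delta x_i}\left[\mathcal F^{\hat h}_{i+\frac12}(t^n)-\mathcal F^{\hat h}_{i-\frac12}(t^n)\right].$$ Assume that $(\overline{\mathbf h}_i^n)^T\boldsymbol\Phi(\xi_j)>0$ for all $1\le j\le M$ and all cells $i$. If $$\Delta t^n<\Delta t^n_h:=\min_{\substack{1\le j\le M\\ i}}\left\{\Delta x_i\left|\frac{(\overline{\mathbf h}^n_i)^T\boldsymbol\Phi(\xi_j)}{\left[\mathcal F^{\hat h}_{i+\frac12}(t^n)-\mathcal F^{\hat h}_{i-\frac12}(t^n)\right]^T\boldsymbol\Phi(\xi_j)}\right|\right\}$$ (a quotient with zero denominator being interpreted as $+\infty$), then for every cell $i$ the flux Jacobian $J(\overline{\mathbf U}_i^{n+1})$, $\overline{\mathbf U}_i^{n+1}=(\overline{\mathbf h}_i^{n+1},\overline{\mathbf q}_i^{n+1})$, is diagonalizable with real eigenvalues.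
   Context: Let $\rho:\mathbb{R}^d\to\mathbb{R}$ be a (Lebesgue) probability density with finite polynomial moments of all orders and $\langle f,g\rangle_\rho=\int_{\mathbb{R}^d} f g\,\rho\,ds$. Let $\Lambda\subset\mathbb{N}_0^d$ be finite with $0\in\Lambda$, $|\Lambda|=K$, $P_\Lambda=\mathrm{span}\{\zeta^\nu:\nu\in\Lambda\}$, $P_\Lambda^r=\mathrm{span}\{\prod_{j=1}^r p_j:p_j\in P_\Lambda\}$, and let $\phi_1\equiv1,\dots,\phi_K$ be an $L^2_\rho$-orthonormal basis of $P_\Lambda$; $\boldsymbol\Phi(\xi)=(\phi_1(\xi),\dots,\phi_K(\xi))^T$. For $\hat y\in\mathbb{R}^K$ let $\mathcal{P}(\hat y)=\sum_{k=1}^K\hat y_k\mathcal{M}_k$, $(\mathcal{M}_k)_{\ell m}=\langle\phi_k,\phi_\ell\phi_m\rangle_\rho$. Let $g>0$. For $\hat U=(\hat h,\hat q)\in\mathbb{R}^{2K}$ with $\mathcal{P}(\hat h)$ invertible let $$F(\hat U)=\begin{pmatrix}\hat q\\ \tfrac12 g\mathcal{P}(\hat h)\hat h+\mathcal{P}(\hat q)\mathcal{P}^{-1}(\hat h)\hat q\end{pmatrix},\qquad J(\hat U)=\frac{\partial F}{\partial\hat U}=\begin{pmatrix}O&I\\ g\mathcal{P}(\hat h)-\mathcal{P}(\hat q)\mathcal{P}^{-1}(\hat h)\mathcal{P}(\hat u)&\mathcal{P}(\hat u)+\mathcal{P}(\hat q)\mathcal{P}^{-1}(\hat h)\end{pmatrix},$$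 with $\hat u=\mathcal{P}^{-1}(\hat h)\hat q$. When $\mathcal{P}(\hat h)$ is positive definite, $J(\hat U)$ has real eigenvalues $\lambda_1\le\dots\le\lambda_{2K}$. The claim that $J(\hat U)$ is diagonalizable with real eigenvalues includes that $\mathcal{P}(\hat h)$ is invertible. The stochastic Galerkin shallow water system is $\hat U_t+F(\hat U)_x=(0,-g\mathcal{P}(\hat h)\hat B_x)^T$. Scheme: there are finitely many cells $\mathcal C_i=[x_{i-1/2},x_{i+1/2}]$ of lengths $\Delta x_i>0$, with cell averages $\overline{\mathbf U}^n_i=(\overline{\mathbf h}^n_i,\overline{\mathbf q}^n_i)\in\mathbb{R}^{2K}$ at time $t^n$. At each interface, $\mathbf U^\pm_{i+1/2}=(\mathbf h^\pm_{i+1/2},\mathbf q^\pm_{i+1/2})\in\mathbb{R}^{2K}$ denote the right ($+$) and left ($-$) pointwise reconstructed values computed from the cell averages at time $t^n$; they are taken as given data for the step, with $\mathcal{P}(\mathbf h^\pm_{i+1/2})$ positive definite so that the following are well defined. Local speeds: $a^-_{i+1/2}=\min\{\lambda_1(J(\mathbf U^-_{i+1/2})),\lambda_1(J(\mathbf U^+_{i+1/2})),0\}$, $a^+_{i+1/2}=\max\{\lambda_{2K}(J(\mathbf U^-_{i+1/2})),\lambda_{2K}(J(\mathbf U^+_{i+1/2})),0\}$. Numerical flux: $$\mathcal F_{i+\frac12}=\frac{a^+_{i+\frac12}F(\mathbf U^-_{i+\frac12})-a^-_{i+\frac12}F(\mathbf U^+_{i+\frac12})}{a^+_{i+\frac12}-a^-_{i+\frac12}}+\frac{a^+_{i+\frac12}a^-_{i+\frac12}}{a^+_{i+\frac12}-a^-_{i+\frac12}}\left[\mathbf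 U^+_{i+\frac12}-\mathbf U^-_{i+\frac12}\right],$$ whose first $K$ components are $$\mathcal F^{\hat h}_{i+\frac12}=\frac{a^+_{i+\frac12}\mathbf q^-_{i+\frac12}-a^-_{i+\frac12}\mathbf q^+_{i+\frac12}}{a^+_{i+\frac12}-a^-_{i+\frac12}}+\frac{a^+_{i+\frac12}a^-_{i+\frac12}}{a^+_{i+\frac12}-a^-_{i+\frac12}}\left[\mathbf h^+_{i+\frac12}-\mathbf h^-_{i+\frac12}\right].$$ The Forward Euler step is $\overline{\mathbf U}_i^{n+1}=\overline{\mathbf U}_i^n-\frac{\Delta t^n}{\Delta x_i}[\mathcal F_{i+1/2}(t^n)-\mathcal F_{i-1/2}(t^n)]+\Delta t^n\,\overline{\mathbf S}_i$, where the source term $\overline{\mathbf S}_i\in\mathbb{R}^{2K}$ has its first $K$ components equal to zero and its last $K$ components equal to $-\frac{1}{\Delta x_i}g\mathcal{P}(\overline{\mathbf h}^n_i)(\mathbf B_{i+1/2}-\mathbf B_{i-1/2})$, with $\mathbf B_{i+1/2}\in\mathbb{R}^K$ given bottom coefficient vectors. *)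

theory Defs
  imports "HOL-Analysis.Analysis" "HOL-Library.Function_Algebras"
begin

section \<open>Polynomial spaces, density and quadrature\<close>

interpretation fun_space: vector_space "\<lambda>(c::real) (f::'a \<Rightarrow> real) x. c * f x"
  by unfold_locales (auto simp: fun_eq_iff algebra_simps)

definition multi_monom :: "('d::finite \<Rightarrow> nat) \<Rightarrow> real^'d \<Rightarrow> real" where
  "multi_monom \<nu> \<zeta> = (\<Prod>i\<in>UNIV. (\<zeta> $ i) ^ \<nu> i)"

definition poly_space :: "('d::finite \<Rightarrow> nat) set \<Rightarrow> (real^'d \<Rightarrow> real) set" where
  "poly_space \<Lambda> = fun_space.span (multi_monom ` \<Lambda>)"

definition poly_space_power :: "('d::finite \<Rightarrow> nat) set \<Rightarrow> nat \<Rightarrow> (real^'d \<Rightarrow> real) set" where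
  "poly_space_power \<Lambda> r =
     fun_space.span {(\<lambda>\<zeta>. \<Prod>j=1..r. p j \<zeta>) |p. \<forall>j\<in>{1..r}. p j \<in> poly_space \<Lambda>}"

definition density_with_moments :: "(real^'d::finite \<Rightarrow> real) \<Rightarrow> bool" where
  "density_with_moments \<rho> \<longleftrightarrow>
     (\<forall>s. 0 \<le> \<rho> s) \<and> integrable lebesgue \<rho> \<and> (\<integral>s. \<rho> s \<partial>lebesgue) = 1 \<and>
     (\<forall>\<nu>. integrable lebesgue (\<lambda>s. multi_monom \<nu> s * \<rho> s))"

definition rho_inner ::
  "(real^'d::finite \<Rightarrow> real) \<Rightarrow> (real^'d \<Rightarrow> real) \<Rightarrow> (real^'d \<Rightarrow> real) \<Rightarrow> real" where
  "rho_inner \<rho> f g = (\<integral>s. f s * g s * \<rho> s \<partial>lebesgue)"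

text \<open>Linear independence of the \<open>\<phi> k\<close> follows from orthonormality.\<close>

definition orthonormal_basis ::
  "(real^'d::finite \<Rightarrow> real) \<Rightarrow> ('d \<Rightarrow> nat) set \<Rightarrow> ('k::finite \<Rightarrow> real^'d \<Rightarrow> real) \<Rightarrow> bool" where
  "orthonormal_basis \<rho> \<Lambda> \<phi> \<longleftrightarrow>
     fun_space.span (range \<phi>) = poly_space \<Lambda> \<and>
     (\<forall>k l. rho_inner \<rho> (\<phi> k) (\<phi> l) = (if k = l then 1 else 0))"

definition exact_quadrature ::
  "(real^'d::finite \<Rightarrow> real) \<Rightarrow> nat \<Rightarrow> (nat \<Rightarrow> real^'d) \<Rightarrow> (nat \<Rightarrow> real) \<Rightarrow> (real^'d \<Rightarrow> real) set \<Rightarrow> bool"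
  where
  "exact_quadrature \<rho> M \<xi> \<tau> V \<longleftrightarrow>
     (\<forall>p\<in>V. (\<integral>s. p s * \<rho> s \<partial>lebesgue) = (\<Sum>j=1..M. p (\<xi> j) * \<tau> j))"

definition basis_vec :: "('k::finite \<Rightarrow> real^'d::finite \<Rightarrow> real) \<Rightarrow> real^'d \<Rightarrow> real^'k" where
  "basis_vec \<phi> \<zeta> = (\<chi> k. \<phi> k \<zeta>)"

definition galerkin_mat ::
  "(real^'d::finite \<Rightarrow> real) \<Rightarrow> ('k::finite \<Rightarrow> real^'d \<Rightarrow> real) \<Rightarrow> real^'k \<Rightarrow> real^'k^'k" where
  "galerkin_mat \<rho> \<phi> y =
     (\<Sum>k\<in>UNIV. (y $ k) *\<^sub>R (\<chi> l m. rho_inner \<rho> (\<phi> k) (\<lambda>s. \<phi> l s * \<phi> m s)))"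


section \<open>Matrices\<close>

definition pos_def :: "real^'n^'n \<Rightarrow> bool" where
  "pos_def A \<longleftrightarrow> transpose A = A \<and> (\<forall>v. v \<noteq> 0 \<longrightarrow> 0 < v \<bullet> (A *v v))"

definition real_eigenvalues :: "real^'n^'n \<Rightarrow> real set" where
  "real_eigenvalues A = {c. \<exists>v. v \<noteq> 0 \<and> A *v v = c *\<^sub>R v}"

text \<open>Similarity over the reals to a diagonal matrix, that is, diagonalizability
  together with all eigenvalues being real.\<close>

definition real_diagonalizable :: "real^'n^'n \<Rightarrow> bool" where
  "real_diagonalizable A \<longleftrightarrow>
     (\<exists>S D :: real^'n^'n. invertible S \<and> (\<forall>i j. i \<noteq> j \<longrightarrow> D $ i $ j = 0) \<and> A = S ** D ** matrix_inv S)"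

text \<open>A vector of length \<open>2K\<close> is indexed by \<open>'k + 'k\<close>, with \<open>Inl\<close> for the first
  \<open>K\<close> components and \<open>Inr\<close> for the last \<open>K\<close>.\<close>

definition h_part :: "real^('k::finite + 'k) \<Rightarrow> real^'k" where
  "h_part U = (\<chi> k. U $ Inl k)"

definition q_part :: "real^('k::finite + 'k) \<Rightarrow> real^'k" where
  "q_part U = (\<chi> k. U $ Inr k)"

definition stack :: "real^'k::finite \<Rightarrow> real^'k \<Rightarrow> real^('k + 'k)" where
  "stack h q = (\<chi> i. case i of Inl k \<Rightarrow> h $ k | Inr k \<Rightarrow> q $ k)"

definition block_mat ::
  "real^'k^'k \<Rightarrow> real^'k^'k \<Rightarrow> real^'k^'k \<Rightarrow> real^'k^'k \<Rightarrow> real^('k::finite + 'k)^('k + 'k)" where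
  "block_mat A B C D = (\<chi> i j. case i of
       Inl k \<Rightarrow> (case j of Inl l \<Rightarrow> A $ k $ l | Inr l \<Rightarrow> B $ k $ l)
     | Inr k \<Rightarrow> (case j of Inl l \<Rightarrow> C $ k $ l | Inr l \<Rightarrow> D $ k $ l))"


section \<open>The stochastic Galerkin shallow water system\<close>

definition velocity ::
  "(real^'d::finite \<Rightarrow> real) \<Rightarrow> ('k::finite \<Rightarrow> real^'d \<Rightarrow> real) \<Rightarrow> real^('k + 'k) \<Rightarrow> real^'k" where
  "velocity \<rho> \<phi> U = matrix_inv (galerkin_mat \<rho> \<phi> (h_part U)) *v q_part U"

definition sw_flux ::
  "(real^'d::finite \<Rightarrow> real) \<Rightarrow> ('k::finite \<Rightarrow> real^'d \<Rightarrow> real) \<Rightarrow> real \<Rightarrow> real^('k + 'k) \<Rightarrow> real^('k + 'k)"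
  where
  "sw_flux \<rho> \<phi> g U =
    (let P = galerkin_mat \<rho> \<phi>; h = h_part U; q = q_part U
     in stack q ((g / 2) *\<^sub>R (P h *v h) + (P q ** matrix_inv (P h)) *v q))"

definition sw_jacobian ::
  "(real^'d::finite \<Rightarrow> real) \<Rightarrow> ('k::finite \<Rightarrow> real^'d \<Rightarrow> real) \<Rightarrow> real \<Rightarrow> real^('k + 'k) \<Rightarrow> real^('k + 'k)^('k + 'k)"
  where
  "sw_jacobian \<rho> \<phi> g U =
    (let P = galerkin_mat \<rho> \<phi>; h = h_part U; q = q_part U; u = velocity \<rho> \<phi> U
     in block_mat 0 (mat 1)
          (g *\<^sub>R P h - P q ** matrix_inv (P h) ** P u) (P u + P q ** matrix_inv (P h)))"


section \<open>The central-upwind scheme\<close>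

text \<open>\<open>Um\<close> and \<open>Up\<close> are the left (minus) and right (plus) states at an interface.
  The speeds are meaningful when \<open>galerkin_mat \<rho> \<phi>\<close> is positive definite at the water heights
  of both states; then every eigenvalue of both Jacobians is real.\<close>

definition speed_minus ::
  "(real^'d::finite \<Rightarrow> real) \<Rightarrow> ('k::finite \<Rightarrow> real^'d \<Rightarrow> real) \<Rightarrow> real \<Rightarrow> real^('k + 'k) \<Rightarrow> real^('k + 'k) \<Rightarrow> real"
  where
  "speed_minus \<rho> \<phi> g Um Up =
     Min {Min (real_eigenvalues (sw_jacobian \<rho> \<phi> g Um)), Min (real_eigenvalues (sw_jacobian \<rho> \<phi> g Up)), 0}"

definition speed_plus ::
  "(real^'d::finite \<Rightarrow> real) \<Rightarrow> ('k::finite \<Rightarrow> real^'d \<Rightarrow> real) \<Rightarrow> real \<Rightarrow> real^('k + 'k) \<Rightarrow> real^('k + 'k) \<Rightarrow> real"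
  where
  "speed_plus \<rho> \<phi> g Um Up =
     Max {Max (real_eigenvalues (sw_jacobian \<rho> \<phi> g Um)), Max (real_eigenvalues (sw_jacobian \<rho> \<phi> g Up)), 0}"

definition num_flux ::
  "(real^'d::finite \<Rightarrow> real) \<Rightarrow> ('k::finite \<Rightarrow> real^'d \<Rightarrow> real) \<Rightarrow> real \<Rightarrow> real^('k + 'k) \<Rightarrow> real^('k + 'k) \<Rightarrow> real^('k + 'k)"
  where
  "num_flux \<rho> \<phi> g Um Up =
    (let am = speed_minus \<rho> \<phi> g Um Up; ap = speed_plus \<rho> \<phi> g Um Up
     in (1 / (ap - am)) *\<^sub>R (ap *\<^sub>R sw_flux \<rho> \<phi> g Um - am *\<^sub>R sw_flux \<rho> \<phi> g Up)
        + (ap * am / (ap - am)) *\<^sub>R (Up - Um))"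

text \<open>Cells are numbered by \<open>i \<in> {1..N}\<close>. Index \<open>i \<in> {0..N}\<close> of an interface quantity
  stands for \<open>i + 1/2\<close>, so that cell \<open>i\<close> is \<open>[x (i - 1), x i]\<close>.\<close>

definition cell_length :: "(nat \<Rightarrow> real) \<Rightarrow> nat \<Rightarrow> real" where
  "cell_length x i = x i - x (i - 1)"

definition source_term ::
  "(real^'d::finite \<Rightarrow> real) \<Rightarrow> ('k::finite \<Rightarrow> real^'d \<Rightarrow> real) \<Rightarrow> real \<Rightarrow> (nat \<Rightarrow> real) \<Rightarrow>
   (nat \<Rightarrow> real^('k + 'k)) \<Rightarrow> (nat \<Rightarrow> real^'k) \<Rightarrow> nat \<Rightarrow> real^('k + 'k)" where
  "source_term \<rho> \<phi> g x Ubar B i =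
     stack 0 (- (g / cell_length x i) *\<^sub>R (galerkin_mat \<rho> \<phi> (h_part (Ubar i)) *v (B i - B (i - 1))))"

definition flux_diff ::
  "(real^'d::finite \<Rightarrow> real) \<Rightarrow> ('k::finite \<Rightarrow> real^'d \<Rightarrow> real) \<Rightarrow> real \<Rightarrow>
   (nat \<Rightarrow> real^('k + 'k)) \<Rightarrow> (nat \<Rightarrow> real^('k + 'k)) \<Rightarrow> nat \<Rightarrow> real^('k + 'k)" where
  "flux_diff \<rho> \<phi> g Um Up i =
     num_flux \<rho> \<phi> g (Um i) (Up i) - num_flux \<rho> \<phi> g (Um (i - 1)) (Up (i - 1))"

definition euler_step ::
  "(real^'d::finite \<Rightarrow> real) \<Rightarrow> ('k::finite \<Rightarrow> real^'d \<Rightarrow> real) \<Rightarrow> real \<Rightarrow> (nat \<Rightarrow> real) \<Rightarrow> real \<Rightarrow>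
   (nat \<Rightarrow> real^('k + 'k)) \<Rightarrow> (nat \<Rightarrow> real^('k + 'k)) \<Rightarrow> (nat \<Rightarrow> real^('k + 'k)) \<Rightarrow>
   (nat \<Rightarrow> real^'k) \<Rightarrow> nat \<Rightarrow> real^('k + 'k)" where
  "euler_step \<rho> \<phi> g x dt Ubar Um Up B i =
     Ubar i - (dt / cell_length x i) *\<^sub>R flux_diff \<rho> \<phi> g Um Up i
     + dt *\<^sub>R source_term \<rho> \<phi> g x Ubar B i"

text \<open>The bound is extended-real because a quotient with zero denominator counts as \<open>\<infinity>\<close>.\<close>

definition time_step_bound ::
  "(real^'d::finite \<Rightarrow> real) \<Rightarrow> ('k::finite \<Rightarrow> real^'d \<Rightarrow> real) \<Rightarrow> real \<Rightarrow> (nat \<Rightarrow> real) \<Rightarrow> nat \<Rightarrow>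
   nat \<Rightarrow> (nat \<Rightarrow> real^'d) \<Rightarrow>
   (nat \<Rightarrow> real^('k + 'k)) \<Rightarrow> (nat \<Rightarrow> real^('k + 'k)) \<Rightarrow> (nat \<Rightarrow> real^('k + 'k)) \<Rightarrow> ereal" where
  "time_step_bound \<rho> \<phi> g x N M \<xi> Ubar Um Up =
     (MIN (i, j) \<in> {1..N} \<times> {1..M}.
        let a = h_part (Ubar i) \<bullet> basis_vec \<phi> (\<xi> j);
            b = h_part (flux_diff \<rho> \<phi> g Um Up i) \<bullet> basis_vec \<phi> (\<xi> j)
        in if b = 0 then \<infinity> else ereal (cell_length x i * \<bar>a / b\<bar>))"


section \<open>The matrix \<open>sw_jacobian\<close> is the derivative of \<open>sw_flux\<close>\<close>

lemma galerkin_mat_nth: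
  "galerkin_mat \<rho> \<phi> y $ l $ m = (\<Sum>k\<in>UNIV. y $ k * rho_inner \<rho> (\<phi> k) (\<lambda>s. \<phi> l s * \<phi> m s))"
  by (simp add: galerkin_mat_def)

lemma galerkin_mat_commute:
  "galerkin_mat \<rho> \<phi> a *v b = galerkin_mat \<rho> \<phi> b *v a"
proof -
  have c: "rho_inner \<rho> (\<phi> k) (\<lambda>s. \<phi> l s * \<phi> m s) = rho_inner \<rho> (\<phi> m) (\<lambda>s. \<phi> l s * \<phi> k s)" for k l m
    unfolding rho_inner_def by (simp add: mult_ac)
  have "(\<Sum>m\<in>UNIV. (\<Sum>k\<in>UNIV. a $ k * rho_inner \<rho> (\<phi> k) (\<lambda>s. \<phi> l s * \<phi> m s)) * b $ m)
      = (\<Sum>m\<in>UNIV. (\<Sum>k\<in>UNIV. b $ k * rho_inner \<rho> (\<phi> k) (\<lambda>s. \<phi> l s * \<phi> m s)) * a $ m)" for l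
    unfolding sum_distrib_right
    by (subst sum.swap) (intro sum.cong refl, subst c, simp)
  then show ?thesis
    by (simp add: vec_eq_iff matrix_vector_mult_def galerkin_mat_nth)
qed

lemma bounded_bilinear_galerkin:
  fixes \<phi> :: "'k::finite \<Rightarrow> real^'d::finite \<Rightarrow> real"
  shows "bounded_bilinear (\<lambda>a b. galerkin_mat \<rho> \<phi> a *v b)"
proof -
  have r: "linear (\<lambda>b. galerkin_mat \<rho> \<phi> a *v b)" for a
    by simp
  then have "linear (\<lambda>a. galerkin_mat \<rho> \<phi> a *v b)" for b
    by (simp add: galerkin_mat_commute[of \<rho> \<phi> _ b])
  with r show ?thesis
    by (simp add: bilinear_def flip: bilinear_conv_bounded_bilinear)
qed

lemma bounded_linear_parts:
  "bounded_linear (h_part :: real^('k::finite + 'k) \<Rightarrow> _)"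
  "bounded_linear (q_part :: real^('k::finite + 'k) \<Rightarrow> _)"
  by (auto simp: linear_conv_bounded_linear[symmetric] h_part_def q_part_def vec_eq_iff
      intro!: linearI)

lemma stack_linear: "bounded_linear (\<lambda>(h, q). stack h q :: real^('k::finite + 'k))"
  by (auto simp: linear_conv_bounded_linear[symmetric] stack_def vec_eq_iff
      intro!: linearI split: sum.splits)

lemma block_mat_mult:
  "block_mat A B C D *v U = stack (A *v h_part U + B *v q_part U) (C *v h_part U + D *v q_part U)"
  by (simp add: vec_eq_iff block_mat_def stack_def h_part_def q_part_def matrix_vector_mult_def
      UNIV_Plus_UNIV[symmetric] sum.Plus split: sum.split del: UNIV_Plus_UNIV)

lemma det_differentiable:
  fixes A :: "'a::real_normed_vector \<Rightarrow> real^'n^'n"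
  assumes "\<And>i j. (\<lambda>x. A x $ i $ j) differentiable (at x)"
  shows "(\<lambda>x. det (A x)) differentiable (at x)"
proof -
  obtain D where D: "\<And>i j. ((\<lambda>x. A x $ i $ j) has_derivative D i j) (at x)"
    using assms unfolding differentiable_def by metis
  have "(\<lambda>x. \<Prod>i\<in>UNIV. A x $ i $ p i) differentiable (at x)" for p :: "'n \<Rightarrow> 'n"
    by (rule differentiableI, rule has_derivative_prod, rule D)
  then show ?thesis
    unfolding det_def by (intro differentiable_sum ballI differentiable_mult) auto
qed

lemma matrix_inv_mult_vec:
  fixes A :: "real^'n^'n"
  assumes "invertible A"
  shows "A *v (matrix_inv A *v b) = b" "matrix_inv A *v (A *v b) = b"
proof -
  have "A ** matrix_inv A = mat 1 \<and> matrix_inv A ** A = mat 1"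
    using assms unfolding invertible_def matrix_inv_def by (rule someI_ex)
  then show "A *v (matrix_inv A *v b) = b" "matrix_inv A *v (A *v b) = b"
    by (simp_all add: matrix_vector_mul_assoc)
qed

lemma velocity_has_derivative:
  fixes \<phi> :: "'k::finite \<Rightarrow> real^'d::finite \<Rightarrow> real"
  assumes inv: "invertible (galerkin_mat \<rho> \<phi> (h_part U))"
  shows "(velocity \<rho> \<phi> has_derivative
           (\<lambda>V. matrix_inv (galerkin_mat \<rho> \<phi> (h_part U)) *v
                  (q_part V - galerkin_mat \<rho> \<phi> (velocity \<rho> \<phi> U) *v h_part V))) (at U)"
proof -
  let ?P = "galerkin_mat \<rho> \<phi>"
  let ?d = "\<lambda>U. det (?P (h_part U))"
  let ?w = "\<lambda>U. \<chi> k. det (\<chi> i j. if j = k then q_part U $ i else ?P (h_part U) $ i $ j) / ?d U"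
  have lin: "(\<lambda>U. U $ s) differentiable (at U)" for s :: "'k + 'k" and U
    by (rule bounded_linear_imp_differentiable) (rule bounded_linear_vec_nth)
  have Pd: "(\<lambda>U. ?P (h_part U) $ i $ j) differentiable (at U)" for i j U
    unfolding galerkin_mat_nth h_part_def by (auto intro!: derivative_intros lin)
  have qd: "(\<lambda>U. q_part U $ i) differentiable (at U)" for i and U :: "real^('k + 'k)"
    unfolding q_part_def by (simp add: lin)
  have dd: "?d differentiable (at U)" for U
    by (rule det_differentiable) (rule Pd)
  have d0: "?d U \<noteq> 0"
    using inv by (simp add: invertible_det_nz)
  have "isCont ?d U"
    using dd differentiable_imp_continuous_within by blast
  then have "(?d \<longlongrightarrow> ?d U) (nhds U)"
    unfolding isCont_def by (rule tendsto_at_iff_tendsto_nhds[where g = ?d, THEN iffD1])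
  then have ev: "\<forall>\<^sub>F V in nhds U. ?d V \<noteq> 0"
    using d0 by (rule tendsto_imp_eventually_ne)
  have w: "velocity \<rho> \<phi> V = ?w V" if "?d V \<noteq> 0" for V
    using cramer[OF that] matrix_inv_mult_vec(1)[of "?P (h_part V)" "q_part V"] that
    by (simp add: velocity_def invertible_det_nz)
  have "(\<lambda>V. if j = k then q_part V $ i else ?P (h_part V) $ i $ j) differentiable (at U)" for i j k
    by (cases "j = k") (simp_all add: Pd qd)
  then have "(\<lambda>V. ?w V $ k) differentiable (at U)" for k
    using d0 by (auto intro!: differentiable_divide det_differentiable dd)
  then have "?w differentiable (at U)"
    by (auto simp: differentiable_componentwise_within[of ?w] Basis_vec_def inner_axis)
  then obtain u' where "(?w has_derivative u') (at U)"
    by (auto simp: differentiable_def)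
  then have u': "(velocity \<rho> \<phi> has_derivative u') (at U)"
  proof (rule has_derivative_transform_eventually)
    show "\<forall>\<^sub>F V in at U. ?w V = velocity \<rho> \<phi> V"
      using ev unfolding eventually_at_filter by (rule eventually_mono) (intro impI, rule w[symmetric])
  qed (simp_all only: w[OF d0] UNIV_I)
  note bb = bounded_bilinear.FDERIV[OF bounded_bilinear_galerkin[of \<rho> \<phi>]]
  have hd: "(h_part has_derivative h_part) (at U)" and qd': "(q_part has_derivative q_part) (at U)"
    by (simp_all add: bounded_linear_imp_has_derivative bounded_linear_parts)
  have "((\<lambda>V. ?P (h_part V) *v velocity \<rho> \<phi> V) has_derivative
          (\<lambda>V. ?P (h_part U) *v u' V + ?P (h_part V) *v velocity \<rho> \<phi> U)) (at U)"
    by (rule bb[OF hd u'])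
  moreover have "((\<lambda>V. ?P (h_part V) *v velocity \<rho> \<phi> V) has_derivative q_part) (at U)"
  proof (rule has_derivative_transform_eventually[OF qd'])
    show "\<forall>\<^sub>F V in at U. q_part V = ?P (h_part V) *v velocity \<rho> \<phi> V"
      using ev unfolding eventually_at_filter
      by (rule eventually_mono) (simp add: velocity_def matrix_inv_mult_vec invertible_det_nz)
  qed (use inv in \<open>simp_all add: velocity_def matrix_inv_mult_vec\<close>)
  ultimately have *: "(\<lambda>V. ?P (h_part U) *v u' V + ?P (h_part V) *v velocity \<rho> \<phi> U) = q_part"
    by (rule has_derivative_unique)
  have "?P (h_part U) *v u' V = q_part V - ?P (velocity \<rho> \<phi> U) *v h_part V" for V
    using fun_cong[OF *, of V]
    by (simp add: galerkin_mat_commute[of \<rho> \<phi> "h_part V"] eq_diff_eq)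
  then have "u' V = matrix_inv (?P (h_part U)) *v (q_part V - ?P (velocity \<rho> \<phi> U) *v h_part V)" for V
    using matrix_inv_mult_vec(2)[OF inv, of "u' V"] by simp
  then have "u' = (\<lambda>V. matrix_inv (?P (h_part U)) *v (q_part V - ?P (velocity \<rho> \<phi> U) *v h_part V))"
    by blast
  with u' show ?thesis by simp
qed

theorem sw_flux_has_derivative:
  fixes \<phi> :: "'k::finite \<Rightarrow> real^'d::finite \<Rightarrow> real"
  assumes inv: "invertible (galerkin_mat \<rho> \<phi> (h_part U))"
  shows "(sw_flux \<rho> \<phi> g has_derivative (\<lambda>V. sw_jacobian \<rho> \<phi> g U *v V)) (at U)"
proof -
  let ?P = "galerkin_mat \<rho> \<phi>"
  note bb = bounded_bilinear.FDERIV[OF bounded_bilinear_galerkin[of \<rho> \<phi>]]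
  have hd: "(h_part has_derivative h_part) (at U)" and qd: "(q_part has_derivative q_part) (at U)"
    by (simp_all add: bounded_linear_imp_has_derivative bounded_linear_parts)
  have F: "sw_flux \<rho> \<phi> g = (\<lambda>V. case (q_part V,
      (g / 2) *\<^sub>R (?P (h_part V) *v h_part V) + ?P (q_part V) *v velocity \<rho> \<phi> V) of (h, q) \<Rightarrow> stack h q)"
    by (simp add: sw_flux_def velocity_def Let_def fun_eq_iff matrix_vector_mul_assoc)
  have half: "(g / 2) *\<^sub>R (?P (h_part U) *v h_part V + ?P (h_part V) *v h_part U)
      = g *\<^sub>R (?P (h_part U) *v h_part V)" for V
    by (simp add: galerkin_mat_commute[of \<rho> \<phi> "h_part V"] flip: scaleR_2)
  have J: "(\<lambda>V. sw_jacobian \<rho> \<phi> g U *v V) = (\<lambda>V. case (q_part V,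
      (g / 2) *\<^sub>R (?P (h_part U) *v h_part V + ?P (h_part V) *v h_part U)
      + (?P (q_part U) *v (matrix_inv (?P (h_part U)) *v (q_part V - ?P (velocity \<rho> \<phi> U) *v h_part V))
         + ?P (q_part V) *v velocity \<rho> \<phi> U)) of (h, q) \<Rightarrow> stack h q)"
    by (simp add: sw_jacobian_def Let_def fun_eq_iff block_mat_mult half half[unfolded add.commute[of "?P (h_part U) *v _"]]
        galerkin_mat_commute[of \<rho> \<phi> "q_part _" "velocity \<rho> \<phi> U"]
        matrix_vector_mult_add_rdistrib matrix_vector_mult_diff_rdistrib matrix_vector_mult_diff_distrib
        scaleR_matrix_vector_assoc matrix_vector_mul_assoc matrix_mul_assoc add_ac add_diff_eq diff_add_eq)
  show ?thesis
    unfolding F J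
    by (intro bounded_linear.has_derivative[OF stack_linear] has_derivative_Pair has_derivative_add
        has_derivative_scaleR_right bb hd qd velocity_has_derivative[OF inv])
qed

corollary jacobian_sw_flux:
  fixes \<phi> :: "'k::finite \<Rightarrow> real^'d::finite \<Rightarrow> real"
  assumes "invertible (galerkin_mat \<rho> \<phi> (h_part U))"
  shows "jacobian (sw_flux \<rho> \<phi> g) (at U) = sw_jacobian \<rho> \<phi> g U"
  using frechet_derivative_at[OF sw_flux_has_derivative[OF assms, of g], symmetric]
  by (simp add: jacobian_def)

end

theory Submission
  imports Defs
begin

text \<open>Exactness on \<open>P\<^sub>\<Lambda>\<^sup>3\<close> gives \<open>\<P>(y) = \<Sum>\<^sub>j \<tau>\<^sub>j (y\<^sup>T \<Phi>(\<xi>\<^sub>j)) \<Phi>(\<xi>\<^sub>j) \<Phi>(\<xi>\<^sub>j)\<^sup>T\<close>, so that positivity of the water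
  height at the nodes makes \<open>\<P>(y)\<close> positive definite; the step size restriction preserves this
  positivity. For positive definite \<open>A = \<P>(h)\<close>, the substitution \<open>w = q - \<P>(u) h\<close> turns the Jacobian
  into the operator with blocks \<open>\<P>(u), I, g A, \<P>(q) A\<^sup>-\<^sup>1\<close>, which is self-adjoint for the inner product
  \<open>g h \<bullet> h' + w \<bullet> A\<^sup>-\<^sup>1 w'\<close>; the spectral theorem concludes.\<close>

section \<open>Operators self-adjoint for a positive definite form\<close>

text \<open>Restates the symmetry clause of \<open>pos_def\<close> as moving a matrix across the
  inner product, the form in which the later computations use it.\<close>

lemma transpose_eq_iff_inner:
  fixes A :: "real^'n^'n"
  shows "transpose A = A \<longleftrightarrow> (\<forall>v w. v \<bullet> (A *v w) = (A *v v) \<bullet> w)"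
proof
  assume "transpose A = A"
  then show "\<forall>v w. v \<bullet> (A *v w) = (A *v v) \<bullet> w"
    by (metis dot_lmul_matrix vector_transpose_matrix)
next
  assume "\<forall>v w. v \<bullet> (A *v w) = (A *v v) \<bullet> w"
  then have "(transpose A *v v) \<bullet> w = (A *v v) \<bullet> w" for v w
    by (metis dot_lmul_matrix transpose_matrix_vector)
  then show "transpose A = A"
    by (metis matrix_eq vector_eq_rdot)
qed

lemma pos_def_invertible:
  fixes A :: "real^'n^'n"
  assumes "pos_def A"
  shows "invertible A"
proof -
  have "v = 0" if "A *v v = 0" for v
    using assms that unfolding pos_def_def by (metis inner_zero_right less_irrefl)
  then show ?thesis
    by (simp add: invertible_left_inverse matrix_left_invertible_ker)
qed

text \<open>Substituting \<open>v = A *v (matrix_inv A *v v)\<close> turns each claim into the same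
  claim about \<open>A\<close>. The inverse is later the weight on the
  \<open>w\<close>-component.\<close>

lemma pos_def_matrix_inv:
  fixes A :: "real^'n^'n"
  assumes "pos_def A"
  shows "pos_def (matrix_inv A)"
proof -
  note inv = matrix_inv_mult_vec[OF pos_def_invertible[OF assms]]
  have sym: "v \<bullet> (A *v w) = (A *v v) \<bullet> w" for v w
    using assms by (simp add: pos_def_def transpose_eq_iff_inner)
  have "v \<bullet> (matrix_inv A *v w) = (matrix_inv A *v v) \<bullet> w" for v w
    using sym[of "matrix_inv A *v v" "matrix_inv A *v w"] by (simp add: inv)
  moreover have "0 < v \<bullet> (matrix_inv A *v v)" if "v \<noteq> 0" for v
  proof -
    have "matrix_inv A *v v \<noteq> 0"
      using inv(1)[of v] that by auto
    then have "0 < (matrix_inv A *v v) \<bullet> (A *v (matrix_inv A *v v))"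
      using assms by (simp add: pos_def_def)
    then show ?thesis
      by (simp add: inv inner_commute)
  qed
  ultimately show ?thesis
    by (simp add: pos_def_def transpose_eq_iff_inner)
qed

text \<open>Along the line \<open>w + t *\<^sub>R v\<close> the quadratic term vanishes, so the form
  is affine in \<open>t\<close>; being bounded below, it has slope zero.\<close>

lemma psd_form_null_vector:
  fixes A :: "real^'n^'n"
  assumes sym: "\<And>v w. v \<bullet> (A *v w) = (A *v v) \<bullet> w"
    and V: "subspace V" and psd: "\<And>v. v \<in> V \<Longrightarrow> 0 \<le> v \<bullet> (A *v v)"
    and "v \<in> V" "w \<in> V" and null: "v \<bullet> (A *v v) = 0"
  shows "w \<bullet> (A *v v) = 0"
proof (rule ccontr)
  define b c where "b = w \<bullet> (A *v v)" and "c = w \<bullet> (A *v w)"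
  assume "w \<bullet> (A *v v) \<noteq> 0"
  then have b: "b \<noteq> 0" by (simp add: b_def)
  have "v \<bullet> (A *v w) = b"
    using sym[of v w] by (simp add: b_def inner_commute)
  then have *: "(w + t *\<^sub>R v) \<bullet> (A *v (w + t *\<^sub>R v)) = c + 2 * t * b" for t
    by (simp add: matrix_vector_right_distrib matrix_vector_mult_scaleR inner_add_left inner_add_right
        null b_def c_def)
  have "0 \<le> c + 2 * t * b" for t
    using psd[of "w + t *\<^sub>R v"] V \<open>v \<in> V\<close> \<open>w \<in> V\<close>
    by (simp add: * subspace_add subspace_scale)
  \<comment> \<open>This \<open>t\<close> is chosen so that the affine function takes the value
    -1.\<close>
  from this[of "- (c + 1) / (2 * b)"] show False
    using b by (simp add: field_simps)
qed

text \<open>The eigenvalue is the maximum \<open>c\<close> of the Rayleigh quotient: then \<open>c S - S J\<close> is positive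
  semidefinite on \<open>V\<close> and vanishes at a maximizer.\<close>

lemma ex_eigenvector_invariant_subspace:
  fixes S J :: "real^'n^'n"
  assumes S: "pos_def S"
    and self: "\<And>v w. v \<bullet> (S *v (J *v w)) = (J *v v) \<bullet> (S *v w)"
    and V: "subspace V" and inv: "\<And>v. v \<in> V \<Longrightarrow> J *v v \<in> V"
    and ne: "z \<in> V" "z \<noteq> 0"
  obtains v c where "v \<in> V" "v \<noteq> 0" "J *v v = c *\<^sub>R v"
proof -
  have symS: "v \<bullet> (S *v w) = (S *v v) \<bullet> w" for v w
    using S by (simp add: pos_def_def transpose_eq_iff_inner)
  have posS: "0 < v \<bullet> (S *v v)" if "v \<noteq> 0" for v
    using S that by (simp add: pos_def_def)
  define R where "R v = (v \<bullet> (S *v (J *v v))) / (v \<bullet> (S *v v))" for v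
  \<comment> \<open>Scale invariance carries the maximum on the compact set \<open>?K\<close> over
    to all nonzero vectors of \<open>V\<close>.\<close>
  have R_scale: "R (t *\<^sub>R v) = R v" if "t \<noteq> 0" for t v
    using that by (simp add: R_def matrix_vector_mult_scaleR)
  let ?K = "sphere 0 1 \<inter> V"
  have "compact ?K"
    by (intro compact_Int_closed compact_sphere closed_subspace V)
  moreover have normalized: "(1 / norm v) *\<^sub>R v \<in> ?K" if "v \<in> V" "v \<noteq> 0" for v
    using that V by (simp add: subspace_scale)
  moreover have "\<forall>v\<in>?K. v \<bullet> (S *v v) \<noteq> 0"
    using posS by (metis IntE less_irrefl norm_zero mem_sphere_0 zero_neq_one)
  then have "continuous_on ?K R"
    unfolding R_def
    by (intro continuous_intros linear_continuous_on_compose[OF _ matrix_vector_mul_linear])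
  ultimately obtain v where v: "v \<in> ?K" and max: "\<And>w. w \<in> ?K \<Longrightarrow> R w \<le> R v"
    using continuous_attains_sup[of ?K R] ne by blast
  have v0: "v \<noteq> 0" using v by auto
  define c where "c = R v"
  define Q where "Q = c *\<^sub>R S - S ** J"
  have Q: "Q *v w = c *\<^sub>R (S *v w) - S *v (J *v w)" for w
    by (simp add: Q_def matrix_vector_mult_diff_rdistrib scaleR_matrix_vector_assoc
        matrix_vector_mul_assoc)
  have symQ: "u \<bullet> (Q *v w) = (Q *v u) \<bullet> w" for u w
    using self[of u w] symS[of u w] symS[of "J *v u" w]
    by (simp add: Q inner_diff_left inner_diff_right)
  have psd: "0 \<le> w \<bullet> (Q *v w)" if "w \<in> V" for w
  proof (cases "w = 0")
    case False
    have "R w \<le> c"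
      using max[OF normalized[OF that False]] R_scale[of "1 / norm w" w] False by (simp add: c_def)
    then show ?thesis
      using posS[OF False] by (simp add: Q inner_diff_right R_def divide_le_eq)
  qed simp
  have "v \<bullet> (Q *v v) = 0"
    using posS[OF v0] by (simp add: Q inner_diff_right c_def R_def)
  then have null: "w \<bullet> (Q *v v) = 0" if "w \<in> V" for w
    using psd_form_null_vector[OF symQ V psd] v that by blast
  \<comment> \<open>Since \<open>Q *v v = S *v ?r\<close> and \<open>?r\<close> stays in the
    invariant subspace \<open>V\<close>, testing with \<open>?r\<close> itself gives
    \<open>?r \<bullet> (S *v ?r) = 0\<close>.\<close>
  let ?r = "c *\<^sub>R v - J *v v"
  have "?r \<in> V"
    using v inv V by (simp add: subspace_diff subspace_scale)
  from null[OF this] have "?r \<bullet> (S *v ?r) = 0"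
    by (simp add: Q matrix_vector_mult_diff_distrib matrix_vector_mult_scaleR)
  then have "?r = 0"
    using posS[of ?r] by force
  then have "J *v v = c *\<^sub>R v" by simp
  with v v0 that show thesis by blast
qed

text \<open>A maximal independent set of eigenvectors is a basis of size \<open>CARD('n)\<close>, so
  it can be indexed by \<open>'n\<close> and used as the columns of the change of basis
  \<open>T\<close>; then \<open>J ** T = T ** D\<close> holds column by column.\<close>

lemma real_diagonalizable_if_eigenvectors_span:
  fixes J :: "real^'n^'n"
  assumes "span {v. \<exists>c. J *v v = c *\<^sub>R v} = UNIV"
  shows "real_diagonalizable J"
proof -
  obtain Bs where Bs: "Bs \<subseteq> {v. \<exists>c. J *v v = c *\<^sub>R v}" "independent Bs"
      "{v. \<exists>c. J *v v = c *\<^sub>R v} \<subseteq> span Bs"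
    using maximal_independent_subset by blast
  have span: "span Bs = UNIV"
    using assms Bs(3) span_minimal[OF Bs(3)] by auto
  have "card Bs = CARD('n)" "finite Bs"
    using dim_eq_card[OF refl Bs(2)] dim_span[of Bs] Bs(2)
    by (simp_all add: span independent_imp_finite dim_UNIV)
  then obtain b :: "'n \<Rightarrow> real^'n" where b: "bij_betw b UNIV Bs"
    by (metis finite_same_card_bij finite_code)
  then have "b i \<in> Bs" for i
    by (auto simp: bij_betw_def)
  then have "\<exists>c. J *v b i = c *\<^sub>R b i" for i
    using Bs(1) by blast
  then obtain c where c: "\<And>i. J *v b i = c i *\<^sub>R b i"
    by metis
  define T :: "real^'n^'n" where "T = (\<chi> i j. b j $ i)"
  define D :: "real^'n^'n" where "D = (\<chi> i j. if i = j then c i else 0)"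
  have T_axis: "T *v axis i 1 = b i" for i
    by (simp add: T_def vec_eq_iff matrix_vector_mult_basis column_def)
  have "columns T = Bs"
    using b by (auto simp: columns_def column_def T_def bij_betw_def vec_lambda_eta)
  then have invT: "invertible T"
    using span
    by (simp add: invertible_right_inverse matrix_right_invertible_span_columns span_vec_eq)
  have "D *v axis i 1 = c i *\<^sub>R axis i 1" for i
    by (simp add: matrix_vector_mult_basis) (simp add: D_def column_def vec_eq_iff axis_def)
  then have "(J ** T) *v axis i 1 = (T ** D) *v axis i 1" for i
    by (simp add: T_axis c matrix_vector_mult_scaleR flip: matrix_vector_mul_assoc)
  then have "J ** T = T ** D"
    by (simp add: vec_eq_iff matrix_vector_mult_basis column_def)
  then have "T ** D ** matrix_inv T *v w = J *v w" for w
    using invT by (metis matrix_vector_mul_assoc matrix_inv_mult_vec(1))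
  then have "J = T ** D ** matrix_inv T"
    by (simp add: matrix_eq)
  then show ?thesis
    unfolding real_diagonalizable_def using invT
    by (intro exI[of _ T] exI[of _ D]) (simp add: D_def)
qed

text \<open>The \<open>S\<close>-orthogonal complement of the eigenvectors is invariant under
  \<open>J\<close>. If it were nonzero it would contain an eigenvector, which would be
  \<open>S\<close>-orthogonal to itself.\<close>

theorem real_diagonalizable_self_adjoint:
  fixes S J :: "real^'n^'n"
  assumes S: "pos_def S"
    and self: "\<And>v w. v \<bullet> (S *v (J *v w)) = (J *v v) \<bullet> (S *v w)"
  shows "real_diagonalizable J"
proof (rule real_diagonalizable_if_eigenvectors_span, rule ccontr)
  let ?E = "{v. \<exists>c. J *v v = c *\<^sub>R v}"
  define V where "V = {w. \<forall>v\<in>?E. v \<bullet> (S *v w) = 0}"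
  assume "span ?E \<noteq> UNIV"
  then obtain a where a: "a \<noteq> 0" "\<And>v. v \<in> span ?E \<Longrightarrow> a \<bullet> v = 0"
    using span_not_UNIV_orthogonal by blast
  \<comment> \<open>\<open>a\<close> is orthogonal to the eigenvectors in the Euclidean sense;
    applying the inverse of \<open>S\<close> makes this \<open>S\<close>-orthogonality.\<close>
  let ?z = "matrix_inv S *v a"
  have Sz: "S *v ?z = a"
    by (rule matrix_inv_mult_vec(1)[OF pos_def_invertible[OF S]])
  then have z: "?z \<noteq> 0"
    using a(1) by auto
  have zV: "?z \<in> V"
    using a(2) by (auto simp: V_def Sz inner_commute[of _ a] span_base)
  have V: "subspace V"
    by (auto simp: V_def subspace_def matrix_vector_right_distrib inner_add_right
        matrix_vector_mult_scaleR)
  have inv: "J *v w \<in> V" if "w \<in> V" for w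
    using that self by (auto simp: V_def)
  obtain v c where v: "v \<in> V" "v \<noteq> 0" "J *v v = c *\<^sub>R v"
    using ex_eigenvector_invariant_subspace[OF S self V inv zV z] by blast
  then have "v \<bullet> (S *v v) = 0"
    by (auto simp: V_def)
  with S v(2) show False
    by (auto simp: pos_def_def)
qed

section \<open>Hyperbolicity of the shallow water system\<close>

lemma inner_stack: "stack a b \<bullet> U = a \<bullet> h_part U + b \<bullet> q_part U"
  by (simp add: inner_vec_def stack_def h_part_def q_part_def UNIV_Plus_UNIV[symmetric] sum.Plus
      del: UNIV_Plus_UNIV)

lemma h_part_stack [simp]: "h_part (stack a b) = a"
  and q_part_stack [simp]: "q_part (stack a b) = b"
  by (simp_all add: h_part_def q_part_def stack_def vec_eq_iff)

lemma eq_0_iff_parts_eq_0: "U = 0 \<longleftrightarrow> h_part U = 0 \<and> q_part U = 0"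
  by (simp add: vec_eq_iff h_part_def q_part_def split_sum_all)

lemma transpose_galerkin_mat: "transpose (galerkin_mat \<rho> \<phi> y) = galerkin_mat \<rho> \<phi> y"
  by (simp add: vec_eq_iff transpose_def galerkin_mat_nth mult.commute)

text \<open>\<open>S\<close> is the Gram matrix of \<open>g h \<bullet> h' + (q - W h) \<bullet> A\<^sup>-\<^sup>1 (q' - W h')\<close>.\<close>

lemma real_diagonalizable_block:
  fixes A C W :: "real^'k::finite^'k"
  assumes A: "pos_def A" and C: "transpose C = C" and W: "transpose W = W" and g: "0 < g"
  shows "real_diagonalizable
    (block_mat 0 (mat 1) (g *\<^sub>R A - C ** matrix_inv A ** W) (W + C ** matrix_inv A))"
    (is "real_diagonalizable ?J")
proof -
  let ?I = "matrix_inv A"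
  define S where "S = block_mat (g *\<^sub>R mat 1 + W ** ?I ** W) (- (W ** ?I)) (- (?I ** W)) ?I"
  define r where "r U = q_part U - W *v h_part U" for U
  note inv = matrix_inv_mult_vec[OF pos_def_invertible[OF A]]
  have symI: "v \<bullet> (?I *v w) = (?I *v v) \<bullet> w" and symC: "v \<bullet> (C *v w) = (C *v v) \<bullet> w"
    and symW: "v \<bullet> (W *v w) = (W *v v) \<bullet> w" for v w
    using pos_def_matrix_inv[OF A] C W by (simp_all add: pos_def_def transpose_eq_iff_inner)
  have minus_mult: "(- X) *v v = - (X *v v)" for X :: "real^'k^'k" and v
    using matrix_vector_mult_diff_rdistrib[of 0 X v] by simp
  have SU: "S *v U = stack (g *\<^sub>R h_part U - W *v (?I *v r U)) (?I *v r U)" for U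
    by (simp add: S_def block_mat_mult r_def minus_mult matrix_vector_mult_add_rdistrib
        matrix_vector_mult_diff_distrib scaleR_matrix_vector_assoc[symmetric] diff_diff_eq2
        flip: matrix_vector_mul_assoc)
  have form: "U \<bullet> (S *v V) = g * (h_part U \<bullet> h_part V) + r U \<bullet> (?I *v r V)" for U V
    using symW[of "h_part U" "?I *v r V"]
    unfolding inner_commute[of U] SU inner_stack
    by (simp add: r_def[of U] inner_diff_left inner_diff_right inner_commute)
  \<comment> \<open>In the coordinates \<open>h_part U\<close> and \<open>r U\<close> the terms in
    \<open>W *v q_part U\<close> cancel, leaving the blocks \<open>W\<close>, \<open>mat 1\<close>,
    \<open>g *\<^sub>R A\<close> and \<open>C ** ?I\<close>.\<close>
  have JU: "h_part (?J *v U) = W *v h_part U + r U"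
    "r (?J *v U) = g *\<^sub>R (A *v h_part U) + C *v (?I *v r U)" for U
    by (simp_all add: block_mat_mult r_def matrix_vector_mult_add_rdistrib
        matrix_vector_mult_diff_rdistrib matrix_vector_mult_diff_distrib
        scaleR_matrix_vector_assoc[symmetric] flip: matrix_vector_mul_assoc)
  have "pos_def S"
    unfolding pos_def_def transpose_eq_iff_inner
  proof (intro conjI allI impI)
    show "U \<bullet> (S *v V) = (S *v U) \<bullet> V" for U V
      using symI[of "r U" "r V"] unfolding inner_commute[of "S *v U"] form
      by (simp add: inner_commute)
    fix U :: "real^('k + 'k)" assume "U \<noteq> 0"
    have posI: "0 \<le> v \<bullet> (?I *v v)" "v \<noteq> 0 \<Longrightarrow> 0 < v \<bullet> (?I *v v)" for v
      using pos_def_matrix_inv[OF A] by (cases "v = 0"; simp add: pos_def_def less_imp_le)+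
    show "0 < U \<bullet> (S *v U)"
    proof (cases "h_part U = 0")
      case True
      then have "r U \<noteq> 0"
        using \<open>U \<noteq> 0\<close> by (simp add: r_def eq_0_iff_parts_eq_0)
      with True posI(2) show ?thesis by (simp add: form)
    next
      case False
      then show ?thesis
        using g posI(1)[of "r U"] by (simp add: form add_pos_nonneg)
    qed
  qed
  \<comment> \<open>The weights of the form balance the off-diagonal blocks: both cross terms become
    \<open>g\<close> times a product of an \<open>h_part\<close> with an \<open>r\<close>. The
    diagonal blocks contribute \<open>W\<close> and \<open>?I ** C ** ?I\<close>, both
    symmetric.\<close>
  moreover have "U \<bullet> (S *v (?J *v V)) = (?J *v U) \<bullet> (S *v V)" for U V
  proof -
    have IA: "(A *v h_part U) \<bullet> (?I *v r V) = h_part U \<bullet> r V"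
      using symI[of "A *v h_part U" "r V"] by (simp add: inv)
    have IC: "(C *v (?I *v r U)) \<bullet> (?I *v r V) = r U \<bullet> (?I *v (C *v (?I *v r V)))"
      by (simp add: symI symC)
    show ?thesis
      unfolding form JU matrix_vector_right_distrib matrix_vector_mult_scaleR inner_add_left
        inner_add_right inner_scaleR_left inner_scaleR_right inv symW IA IC
      by argo
  qed
  ultimately show ?thesis
    by (rule real_diagonalizable_self_adjoint)
qed

text \<open>Here \<open>W\<close> and \<open>C\<close> are the Galerkin matrices of the velocity and
  the discharge, which are symmetric whatever their argument.\<close>

corollary real_diagonalizable_sw_jacobian:
  assumes "pos_def (galerkin_mat \<rho> \<phi> (h_part U))" "0 < g"
  shows "real_diagonalizable (sw_jacobian \<rho> \<phi> g U)"
  using assms unfolding sw_jacobian_def Let_def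
  by (intro real_diagonalizable_block transpose_galerkin_mat)

section \<open>Positivity at the quadrature nodes\<close>

text \<open>The entries of \<open>galerkin_mat\<close> are combinations of integrals of such
  products, bracketed as in \<open>rho_inner\<close>, so the quadrature evaluates them
  exactly.\<close>

lemma triple_product_in_poly_space_power:
  assumes "p \<in> poly_space \<Lambda>" "q \<in> poly_space \<Lambda>" "r \<in> poly_space \<Lambda>"
  shows "(\<lambda>\<zeta>. p \<zeta> * (q \<zeta> * r \<zeta>)) \<in> poly_space_power \<Lambda> 3"
  unfolding poly_space_power_def
proof (rule fun_space.span_base, rule CollectI, intro exI conjI)
  let ?f = "\<lambda>j::nat. if j = 1 then p else if j = 2 then q else r"
  show "(\<lambda>\<zeta>. p \<zeta> * (q \<zeta> * r \<zeta>)) = (\<lambda>\<zeta>. \<Prod>j = 1..3. ?f j \<zeta>)"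
    by (simp add: eval_nat_numeral mult.assoc)
  show "\<forall>j\<in>{1..3}. ?f j \<in> poly_space \<Lambda>"
    using assms by simp
qed

text \<open>The quadrature writes the form as a sum of squares of nodal values with positive
  weights. It is strictly positive because a nonzero \<open>v\<close> has a nonzero value at some
  node.\<close>

lemma pos_def_galerkin_mat:
  fixes \<phi> :: "'k::finite \<Rightarrow> real^'d::finite \<Rightarrow> real"
  assumes basis: "orthonormal_basis \<rho> \<Lambda> \<phi>" and one: "\<phi> k1 = (\<lambda>_. 1)"
    and \<tau>: "\<forall>j\<in>{1..M}. 0 < \<tau> j"
    and exact: "exact_quadrature \<rho> M \<xi> \<tau> (poly_space_power \<Lambda> 3)"
    and pos: "\<forall>j\<in>{1..M}. 0 < y \<bullet> basis_vec \<phi> (\<xi> j)"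
  shows "pos_def (galerkin_mat \<rho> \<phi> y)"
proof -
  have \<phi>: "\<phi> k \<in> poly_space \<Lambda>" for k
    using basis fun_space.span_base[of "\<phi> k" "range \<phi>"] by (simp add: orthonormal_basis_def)
  have triple: "rho_inner \<rho> (\<phi> k) (\<lambda>s. \<phi> l s * \<phi> m s)
      = (\<Sum>j=1..M. \<phi> k (\<xi> j) * (\<phi> l (\<xi> j) * \<phi> m (\<xi> j)) * \<tau> j)" for k l m
    using exact triple_product_in_poly_space_power[OF \<phi>[of k] \<phi>[of l] \<phi>[of m]]
    by (simp add: exact_quadrature_def rho_inner_def)
  have ev: "v \<bullet> basis_vec \<phi> s = (\<Sum>k\<in>UNIV. v $ k * \<phi> k s)" for v s
    by (simp add: inner_vec_def basis_vec_def)
  have form: "v \<bullet> (galerkin_mat \<rho> \<phi> z *v v)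
      = (\<Sum>j=1..M. \<tau> j * (z \<bullet> basis_vec \<phi> (\<xi> j)) * (v \<bullet> basis_vec \<phi> (\<xi> j))\<^sup>2)" for z v
  proof -
    have "v \<bullet> (galerkin_mat \<rho> \<phi> z *v v) = (\<Sum>l\<in>UNIV. \<Sum>m\<in>UNIV. \<Sum>k\<in>UNIV. \<Sum>j=1..M.
        \<tau> j * (z $ k * \<phi> k (\<xi> j)) * ((v $ l * \<phi> l (\<xi> j)) * (v $ m * \<phi> m (\<xi> j))))"
      by (simp add: inner_vec_def matrix_vector_mult_def galerkin_mat_nth triple sum_distrib_left
          sum_distrib_right mult_ac)
    \<comment> \<open>Only the sum over nodes moves outward; for fixed \<open>j\<close> the summand
      then factors into three coefficient sums.\<close>
    also have "\<dots> = (\<Sum>j=1..M. \<Sum>l\<in>UNIV. \<Sum>m\<in>UNIV. \<Sum>k\<in>UNIV.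
        \<tau> j * (z $ k * \<phi> k (\<xi> j)) * ((v $ l * \<phi> l (\<xi> j)) * (v $ m * \<phi> m (\<xi> j))))"
      by (simp only: sum.swap[where B = "{1..M}"])
    also have "\<dots> = (\<Sum>j=1..M. \<tau> j * (z \<bullet> basis_vec \<phi> (\<xi> j)) * (v \<bullet> basis_vec \<phi> (\<xi> j))\<^sup>2)"
      by (simp add: ev power2_eq_square sum_product sum_distrib_left sum_distrib_right mult_ac)
    finally show ?thesis .
  qed
  \<comment> \<open>\<open>\<P>(e\<^sub>1) = I\<close>, so the formula for \<open>z = e\<^sub>1\<close> evaluates \<open>v \<bullet> v\<close> by the quadrature: the nodes separate \<open>P\<^sub>\<Lambda>\<close>.\<close>
  have "galerkin_mat \<rho> \<phi> (axis k1 1) = mat 1"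
  proof -
    have "rho_inner \<rho> (\<phi> k1) (\<lambda>s. \<phi> l s * \<phi> m s) = (if l = m then 1 else 0)" for l m
      using basis by (simp add: one rho_inner_def orthonormal_basis_def)
    then show ?thesis
      by (simp add: vec_eq_iff galerkin_mat_nth mat_def axis_def if_distrib[of "\<lambda>t. t * _"] cong: if_cong)
  qed
  moreover have "axis k1 1 \<bullet> basis_vec \<phi> s = 1" for s
    by (simp add: inner_axis' basis_vec_def one)
  ultimately have norm: "v \<bullet> v = (\<Sum>j=1..M. \<tau> j * (v \<bullet> basis_vec \<phi> (\<xi> j))\<^sup>2)" for v
    using form[of v "axis k1 1"] by simp
  have "0 < v \<bullet> (galerkin_mat \<rho> \<phi> y *v v)" if "v \<noteq> 0" for v
  proof -
    have "(\<Sum>j=1..M. \<tau> j * (v \<bullet> basis_vec \<phi> (\<xi> j))\<^sup>2) \<noteq> 0"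
      using that norm[of v] by (metis inner_eq_zero_iff)
    then obtain j where j: "j \<in> {1..M}" "v \<bullet> basis_vec \<phi> (\<xi> j) \<noteq> 0"
      by (metis (no_types, lifting) mult_zero_right sum.neutral zero_power2)
    show ?thesis
      unfolding form
    proof (rule sum_pos2[OF _ j(1)])
      show "0 < \<tau> j * (y \<bullet> basis_vec \<phi> (\<xi> j)) * (v \<bullet> basis_vec \<phi> (\<xi> j))\<^sup>2"
        using \<tau> pos j by simp
      show "0 \<le> \<tau> j * (y \<bullet> basis_vec \<phi> (\<xi> j)) * (v \<bullet> basis_vec \<phi> (\<xi> j))\<^sup>2" if "j \<in> {1..M}" for j
        using \<tau> pos that by (simp add: less_imp_le)
    qed simp
  qed
  then show ?thesis
    by (simp add: pos_def_def transpose_galerkin_mat)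
qed

text \<open>The source term has zero height block, so the bottom data \<open>B\<close> drop out of
  the height update.\<close>

lemma h_part_euler_step:
  "h_part (euler_step \<rho> \<phi> g x dt Ubar Um Up B i)
    = h_part (Ubar i) - (dt / cell_length x i) *\<^sub>R h_part (flux_diff \<rho> \<phi> g Um Up i)"
  by (simp add: euler_step_def source_term_def h_part_def stack_def vec_eq_iff)

text \<open>The nodal height changes from \<open>a\<close> to \<open>a - dt / l * b\<close>. Only
  \<open>b > 0\<close> can lower it, and then \<open>dt < l * a / b\<close> keeps it
  positive.\<close>

lemma water_height_euler_step_pos:
  assumes i: "i \<in> {1..N}" and j: "j \<in> {1..M}" and len: "0 < cell_length x i"
    and a: "0 < h_part (Ubar i) \<bullet> basis_vec \<phi> (\<xi> j)" and dt: "0 < dt"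
    and bound: "ereal dt < time_step_bound \<rho> \<phi> g x N M \<xi> Ubar Um Up"
  shows "0 < h_part (euler_step \<rho> \<phi> g x dt Ubar Um Up B i) \<bullet> basis_vec \<phi> (\<xi> j)"
proof -
  define a where "a = h_part (Ubar i) \<bullet> basis_vec \<phi> (\<xi> j)"
  define b where "b = h_part (flux_diff \<rho> \<phi> g Um Up i) \<bullet> basis_vec \<phi> (\<xi> j)"
  define l where "l = cell_length x i"
  have a0: "0 < a" and l0: "0 < l" using a len by (simp_all add: a_def l_def)
  have "time_step_bound \<rho> \<phi> g x N M \<xi> Ubar Um Up \<le> (if b = 0 then \<infinity> else ereal (l * \<bar>a / b\<bar>))"
    unfolding time_step_bound_def
    by (rule Min_le, simp, rule image_eqI[of _ _ "(i, j)"])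
      (use i j in \<open>simp_all add: a_def b_def l_def Let_def\<close>)
  \<comment> \<open>For \<open>b = 0\<close> the entry of the minimum is infinite and constrains
    nothing, hence the premise.\<close>
  with bound have lt: "b \<noteq> 0 \<Longrightarrow> dt < l * \<bar>a / b\<bar>"
    by (auto dest: less_le_trans)
  have "dt / l * b < a"
  proof (cases "b > 0")
    case True
    then show ?thesis
      using lt a0 l0 by (simp add: field_simps)
  next
    case False
    then have "dt / l * b \<le> 0"
      using dt l0 by (intro mult_nonneg_nonpos) simp_all
    with a0 show ?thesis by simp
  qed
  then show ?thesis
    by (simp add: h_part_euler_step inner_diff_left a_def b_def l_def)
qed

theorem lemma4p2:
  fixes \<rho> :: "real^'d::finite \<Rightarrow> real"
    and \<Lambda> :: "('d \<Rightarrow> nat) set"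
    and \<phi> :: "'k::finite \<Rightarrow> real^'d \<Rightarrow> real"
    and k1 :: 'k
    and \<xi> :: "nat \<Rightarrow> real^'d"
    and \<tau> :: "nat \<Rightarrow> real"
    and M N :: nat
    and g dt :: real
    and x :: "nat \<Rightarrow> real"
    and Ubar Uminus Uplus :: "nat \<Rightarrow> real^('k + 'k)"
    and B :: "nat \<Rightarrow> real^'k"
  assumes "density_with_moments \<rho>"
    and "finite \<Lambda>" and "(\<lambda>_. 0) \<in> \<Lambda>" and "card \<Lambda> = CARD('k)"
    and "orthonormal_basis \<rho> \<Lambda> \<phi>" and "\<phi> k1 = (\<lambda>_. 1)"
    and "\<forall>j\<in>{1..M}. 0 < \<tau> j"
    and "exact_quadrature \<rho> M \<xi> \<tau> (poly_space_power \<Lambda> 3)"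
    and "0 < g"
    and "\<forall>i\<in>{1..N}. 0 < cell_length x i"
    and "\<forall>i\<in>{0..N}. pos_def (galerkin_mat \<rho> \<phi> (h_part (Uminus i)))
                   \<and> pos_def (galerkin_mat \<rho> \<phi> (h_part (Uplus i)))"
    and "\<forall>i\<in>{1..N}. \<forall>j\<in>{1..M}. 0 < h_part (Ubar i) \<bullet> basis_vec \<phi> (\<xi> j)"
    and "0 < dt"
    and "ereal dt < time_step_bound \<rho> \<phi> g x N M \<xi> Ubar Uminus Uplus"
  shows "\<forall>i\<in>{1..N}.
           let U' = euler_step \<rho> \<phi> g x dt Ubar Uminus Uplus B i
           in invertible (galerkin_mat \<rho> \<phi> (h_part U')) \<and>
              real_diagonalizable (sw_jacobian \<rho> \<phi> g U')"
proof
  fix i assume i: "i \<in> {1..N}"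
  let ?U = "euler_step \<rho> \<phi> g x dt Ubar Uminus Uplus B i"
  have "\<forall>j\<in>{1..M}. 0 < h_part ?U \<bullet> basis_vec \<phi> (\<xi> j)"
    using i assms(10,12-14) by (blast intro: water_height_euler_step_pos)
  then have "pos_def (galerkin_mat \<rho> \<phi> (h_part ?U))"
    by (rule pos_def_galerkin_mat[OF assms(5-8)])
  then show "let U' = ?U in invertible (galerkin_mat \<rho> \<phi> (h_part U')) \<and>
      real_diagonalizable (sw_jacobian \<rho> \<phi> g U')"
    using assms(9) by (simp add: pos_def_invertible real_diagonalizable_sw_jacobian)
qed

end
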